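(* The critical exponent of Kimberling's infinite word ${\bf B}$ is $2+\frac{1}{\psi-1}=3.19148788395\cdots$, where $\psi$ is the real zero of $X^3-X^2-X-1$.
   Context: Definition of ${\bf B}$: Let $B_0=00$. Given a binary word $B_i$, factor it into blocks: each letter $1$ is a block by itself, and each maximal run of consecutive $0$'s is a block, which is either $0$ or $00$ (runs of three or more $0$'s never occur). Then $B_{i+1}$ is obtained by replacing each block $0$ by $0$, each block $1$ by $10$, and each block $00$ by $0101$. For example $B_1=0101$, $B_2=010010$, $B_3=0100101100$. For $i\ge 2$, $B_i$ is a prefix of $B_{i+1}$, and ${\bf B}=0100101100\cdots$ is the unique infinite word having all $B_i$, $i\ge 2$, as prefixes. A finite word $w=w[1..n]$ has period $p\ge 1$ if $w[i]=w[i+p]$ for all $1\le i\le n-p$; the smallest positive period is denoted $\mathrm{per}(w)$. The exponent of a finite nonempty word $w$ is $\exp(w)=|w|/\mathrm{per}(w)$. The critical exponent of an infinite word ${\bf x}$ is $\sup\{\exp(w): w \text{ is a nonempty factor of } {\bf x}\}$, where a factor is a finite contiguous block of letters. *)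

theory Defs
  imports
    Complex_Main
    "HOL-Library.Z2"
    "HOL-Library.Omega_Words_Fun"
    "HOL-Library.Extended_Real"
begin

section \<open>Periods and exponents\<close>

text \<open>
  Finite words are lists, indexed from 0. Infinite words are functions on the natural numbers;
  \<open>x [i \<rightarrow> j]\<close> is the list \<open>[x i, ..., x (j - 1)]\<close>, so the factors of \<open>x\<close> are the lists of this form.
\<close>

definition has_period :: "'a list \<Rightarrow> nat \<Rightarrow> bool" where
  "has_period w p \<longleftrightarrow> p \<ge> 1 \<and> (\<forall>i. i + p < length w \<longrightarrow> w ! i = w ! (i + p))"

definition per :: "'a list \<Rightarrow> nat" where
  "per w = (LEAST p. has_period w p)"

definition exponent :: "'a list \<Rightarrow> real" where
  "exponent w = real (length w) / real (per w)"

definition is_factor :: "'a list \<Rightarrow> 'a word \<Rightarrow> bool" where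
  "is_factor w x \<longleftrightarrow> (\<exists>i j. w = x [i \<rightarrow> j])"

text \<open>The supremum may be infinite, hence the extended reals.\<close>

definition critical_exponent :: "'a word \<Rightarrow> ereal" where
  "critical_exponent x = Sup {ereal (exponent w) | w. w \<noteq> [] \<and> is_factor w x}"


section \<open>Kimberling's word\<close>

function blocks :: "bit list \<Rightarrow> bit list list" where
  "blocks [] = []"
| "blocks (a # w) =
    (if a = 1 then [1] # blocks w
     else (a # takeWhile (\<lambda>c. c = 0) w) # blocks (dropWhile (\<lambda>c. c = 0) w))"
  by pat_completeness auto
termination
  by (relation "measure length") (auto simp: length_dropWhile_le less_Suc_eq_le)

text \<open>
  Only the three blocks \<open>0\<close>, \<open>1\<close>, \<open>00\<close> have a specified image; lemma \<open>blocks_kimb\<close> below shows that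
  no other block occurs in the words considered.
\<close>

definition block_image :: "bit list \<Rightarrow> bit list" where
  "block_image b =
    (if b = [0] then [0]
     else if b = [1] then [1, 0]
     else if b = [0, 0] then [0, 1, 0, 1]
     else undefined)"

definition kimb_step :: "bit list \<Rightarrow> bit list" where
  "kimb_step w = concat (map block_image (blocks w))"

fun kimb :: "nat \<Rightarrow> bit list" where
  "kimb 0 = [0, 0]"
| "kimb (Suc i) = kimb_step (kimb i)"

definition has_kimb_prefixes :: "bit word \<Rightarrow> bool" where
  "has_kimb_prefixes x \<longleftrightarrow> (\<forall>i\<ge>2. x [0 \<rightarrow> length (kimb i)] = kimb i)"

text \<open>Existence and uniqueness are lemma \<open>ex1_has_kimb_prefixes\<close> below.\<close>

definition kimberling :: "bit word" where
  "kimberling = (THE x. has_kimb_prefixes x)"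


section \<open>The constant\<close>

text \<open>Existence and uniqueness are lemma \<open>ex1_psi\<close> below.\<close>

definition psi :: real where
  "psi = (THE x::real. x ^ 3 - x ^ 2 - x - 1 = 0)"


section \<open>Well-definedness\<close>

lemma kimb_step_Nil [simp]: "kimb_step [] = []"
  by (simp add: kimb_step_def)

lemma kimb_step_1 [simp]: "kimb_step (1 # w) = 1 # 0 # kimb_step w"
  by (simp add: kimb_step_def block_image_def)

lemma kimb_step_0: "w = [] \<or> hd w = 1 \<Longrightarrow> kimb_step (0 # w) = 0 # kimb_step w"
  by (cases w) (auto simp: kimb_step_def block_image_def)

lemma kimb_step_00:
  "w = [] \<or> hd w = 1 \<Longrightarrow> kimb_step (0 # 0 # w) = 0 # 1 # 0 # 1 # kimb_step w"
  by (cases w) (auto simp: kimb_step_def block_image_def)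

text \<open>The words all of whose runs of zeros have length at most 2.\<close>

inductive short_runs :: "bit list \<Rightarrow> bool" where
  Nil: "short_runs []"
| one: "short_runs w \<Longrightarrow> short_runs (1 # w)"
| zero: "short_runs w \<Longrightarrow> w = [] \<or> hd w = 1 \<Longrightarrow> short_runs (0 # w)"
| zero2: "short_runs w \<Longrightarrow> w = [] \<or> hd w = 1 \<Longrightarrow> short_runs (0 # 0 # w)"

lemma blocks_short_runs: "short_runs w \<Longrightarrow> set (blocks w) \<subseteq> {[0], [1], [0, 0]}"
proof (induction rule: short_runs.induct)
  case (zero w)
  then show ?case by (cases w) auto
next
  case (zero2 w)
  then show ?case by (cases w) auto
qed auto

lemma short_runs_kimb_step:
  "short_runs w \<Longrightarrow> short_runs (kimb_step w) \<and> short_runs (0 # kimb_step w)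
     \<and> (w = [] \<or> hd w = 1 \<longrightarrow> kimb_step w = [] \<or> hd (kimb_step w) = 1)"
  by (induction rule: short_runs.induct)
     (auto simp: kimb_step_0 kimb_step_00 intro!: short_runs.intros)

lemma short_runs_kimb: "short_runs (kimb i)"
  by (induction i) (auto simp: short_runs_kimb_step intro: short_runs.intros)

lemma blocks_kimb: "set (blocks (kimb i)) \<subseteq> {[0], [1], [0, 0]}"
  by (rule blocks_short_runs[OF short_runs_kimb])

lemma kimb_step_append:
  "short_runs w \<Longrightarrow> w = u @ z \<Longrightarrow> \<exists>z'. kimb_step w = kimb_step u @ z'"
proof (induction arbitrary: u rule: short_runs.induct)
  case Nil
  then show ?case by simp
next
  case (one w)
  then show ?case by (cases u) auto
next
  case (zero w)
  show ?case
  proof (cases u)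
    case (Cons a u')
    then have u: "a = 0" "w = u' @ z" using zero.prems by auto
    then have "u' = [] \<or> hd u' = 1" using zero.hyps by (cases u') auto
    with u Cons zero show ?thesis by (auto simp: kimb_step_0)
  qed simp
next
  case (zero2 w)
  show ?case
  proof (cases u)
    case (Cons a v)
    note Cons1 = this
    show ?thesis
    proof (cases v)
      case Nil
      with Cons1 zero2 show ?thesis by (auto simp: kimb_step_0 kimb_step_00)
    next
      case (Cons b u')
      with Cons1 have u: "a = 0" "b = 0" "w = u' @ z" using zero2.prems by auto
      then have "u' = [] \<or> hd u' = 1" using zero2.hyps by (cases u') auto
      with u Cons Cons1 zero2 show ?thesis by (auto simp: kimb_step_00)
    qed
  qed simp
qed

lemma kimb_small:
  "kimb 1 = [0,1,0,1]" "kimb 2 = [0,1,0,0,1,0]" "kimb 3 = [0,1,0,0,1,0,1,1,0,0]"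
  by (simp_all add: kimb_step_0 kimb_step_00 numeral_2_eq_2 numeral_3_eq_3)

lemma kimb_append_Suc: "i \<ge> 2 \<Longrightarrow> \<exists>z. kimb (Suc i) = kimb i @ z"
proof (induction i rule: dec_induct)
  case base
  then show ?case using kimb_small by (simp add: numeral_3_eq_3 numeral_2_eq_2)
next
  case (step i)
  then show ?case using kimb_step_append[OF short_runs_kimb] by (metis kimb.simps(2))
qed

lemma kimb_append: "2 \<le> i \<Longrightarrow> i \<le> j \<Longrightarrow> \<exists>z. kimb j = kimb i @ z"
proof (induction j)
  case (Suc j)
  then show ?case
    using kimb_append_Suc[of j] by (metis append.assoc append_Nil2 le_Suc_eq le_trans)
qed auto

lemma length_kimb_step:
  "short_runs w \<Longrightarrow> length w \<le> length (kimb_step w) \<and>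
     (1 \<in> set w \<longrightarrow> length w < length (kimb_step w) \<and> 1 \<in> set (kimb_step w))"
  by (induction rule: short_runs.induct) (auto simp: kimb_step_0 kimb_step_00)

lemma length_kimb: "i < length (kimb (i + 2)) \<and> 1 \<in> set (kimb (i + 2))"
proof (induction i)
  case 0
  have "0 + 2 = (2::nat)" by simp
  then show ?case by (simp only: kimb_small) simp
next
  case (Suc i)
  have "kimb (Suc i + 2) = kimb_step (kimb (i + 2))" by simp
  then show ?case using length_kimb_step[OF short_runs_kimb[of "i + 2"]] Suc
    by (auto simp del: kimb.simps add_2_eq_Suc')
qed

lemma ex1_has_kimb_prefixes: "\<exists>!x. has_kimb_prefixes x"
proof (rule ex1I)
  let ?x = "\<lambda>n. kimb (n + 2) ! n"
  show "has_kimb_prefixes ?x"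
    unfolding has_kimb_prefixes_def
  proof (intro allI impI nth_equalityI)
    fix i n :: nat
    assume i: "2 \<le> i" and n: "n < length (?x [0 \<rightarrow> length (kimb i)])"
    from n have n': "n < length (kimb i)" by simp
    have "kimb (n + 2) ! n = kimb i ! n"
    proof (cases "n + 2 \<le> i")
      case True
      then show ?thesis using kimb_append[of "n + 2" i] length_kimb[of n] by (auto simp: nth_append)
    next
      case False
      then show ?thesis using kimb_append[of i "n + 2"] i n' by (auto simp: nth_append)
    qed
    then show "(?x [0 \<rightarrow> length (kimb i)]) ! n = kimb i ! n" using n' by simp
  qed simp
next
  fix y
  assume "has_kimb_prefixes y"
  then have y: "y [0 \<rightarrow> length (kimb (n + 2))] = kimb (n + 2)" for n
    unfolding has_kimb_prefixes_def by (metis le_add2)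
  show "y = (\<lambda>n. kimb (n + 2) ! n)"
  proof
    fix n
    have "(y [0 \<rightarrow> length (kimb (n + 2))]) ! n = y n"
      using length_kimb[of n] by (subst subsequence_nth) auto
    then show "y n = kimb (n + 2) ! n" using y[of n] by simp
  qed
qed

lemma ex1_psi: "\<exists>!x::real. x ^ 3 - x ^ 2 - x - 1 = 0"
proof (rule ex_ex1I)
  have "\<exists>x::real. 1 \<le> x \<and> x \<le> 2 \<and> x ^ 3 - x ^ 2 - x - 1 = 0"
    by (rule IVT') (auto intro!: continuous_intros)
  then show "\<exists>x::real. x ^ 3 - x ^ 2 - x - 1 = 0" by blast
next
  have gt1: "x > 1" if "x ^ 3 - x ^ 2 - x - 1 = 0" for x :: real
  proof (rule ccontr)
    assume "\<not> x > 1"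
    then have "(x - 1) * (x + 1) ^ 2 \<le> 0" by (simp add: mult_nonpos_nonneg)
    moreover have "(x - 1) * (x + 1) ^ 2 = (x ^ 3 - x ^ 2 - x - 1) + 2 * x ^ 2"
      by (simp add: power2_eq_square power3_eq_cube algebra_simps)
    ultimately have "x ^ 2 \<le> 0" using that by linarith
    then have "x = 0" by simp
    with that show False by simp
  qed
  fix x y :: real
  assume x: "x ^ 3 - x ^ 2 - x - 1 = 0" and y: "y ^ 3 - y ^ 2 - y - 1 = 0"
  have "(x - y) * (x * (x - 1) + y * (y - 1) + (x * y - 1)) = 0"
    using x y by (simp add: power2_eq_square power3_eq_cube algebra_simps)
  moreover have "x * (x - 1) + y * (y - 1) + (x * y - 1) > 0"
    using gt1[OF x] gt1[OF y] by (intro add_pos_pos) (auto simp: less_1_mult)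
  ultimately show "x = y" by simp
qed

end

(* Cutting the word after its initial 0 in front of every occurrence of 10 shows that it is 0 H(t),
   where t is the Tribonacci word, the fixed point of tau: A -> AB, B -> AC, C -> A, and
   H: A -> 100, B -> 101, C -> 10.

   A repetition with period word u, of length |u| + |m|, is a match of m with its shift by |u|.
   In t, a maximal match m is empty or equals tau(m') A for a maximal match m' with period word u',
   where u is conjugate to tau(u').  Descending to an empty match, a period word u at level n
   supports a match of length at most the sum of the lengths of the H(tau^k(A)) with k < n, plus 4
   for the common prefixes and suffixes of images of different letters, and no period is shorter
   than that coming from u = C.  So the exponent is governed by the ratio of the partial sums of
   Tribonacci-like numbers to the numbers themselves, which stays below its limit psi / (psi - 1).
   This margin does not always absorb the full 4; but when 4 is attained, the mismatching pairs at
   the two ends differ, so that u is not the single letter C and a larger period compensates.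
   The occurrence of C at position 3 of t yields repetitions that reach the limit. *)

theory Submission
  imports Defs
begin

section \<open>Tribonacci numbers and the constant\<close>

fun trib :: "nat \<Rightarrow> nat" where
  "trib 0 = 1"
| "trib (Suc 0) = 2"
| "trib (Suc (Suc 0)) = 3"
| "trib (Suc (Suc (Suc n))) = trib (Suc (Suc n)) + trib (Suc n) + trib n"

lemma trib_gt: "n < trib n"
  by (induction n rule: trib.induct) auto

lemma trib_Suc2_ge: "trib (Suc n) + trib n \<le> trib (Suc (Suc n))"
  by (cases n) auto

lemma trib_mono_Suc: "trib n \<le> trib (Suc n)"
  by (induction n rule: trib.induct) auto

definition trib_sum :: "nat \<Rightarrow> nat" where
  "trib_sum n = (\<Sum>k<n. trib k)"

lemma trib_sum_Suc [simp]: "trib_sum (Suc n) = trib_sum n + trib n"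
  by (simp add: trib_sum_def)

lemma trib_sum_0 [simp]: "trib_sum 0 = 0"
  by (simp add: trib_sum_def)

lemma psi_root: "psi ^ 3 - psi ^ 2 - psi - 1 = 0"
  unfolding psi_def by (rule theI'[OF ex1_psi])

lemma psi_gt_1: "psi > 1"
proof (rule ccontr)
  assume "\<not> psi > 1"
  then have "(psi - 1) * (psi + 1) ^ 2 \<le> 0" by (simp add: mult_nonpos_nonneg)
  moreover have "(psi - 1) * (psi + 1) ^ 2 = (psi ^ 3 - psi ^ 2 - psi - 1) + 2 * psi ^ 2"
    by (simp add: power2_eq_square power3_eq_cube algebra_simps)
  ultimately have "psi = 0" using psi_root by simp
  with psi_root show False by simp
qed

text \<open>The critical exponent minus one: a match of length \<open>e\<close> with shift
  \<open>p\<close> will satisfy \<open>e <= kappa * p\<close>. It equals psi / (psi - 1), the limit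
  of \<open>trib_sum (Suc n) / trib n\<close>.\<close>

definition kappa :: real where
  "kappa = 1 + 1 / (psi - 1)"

lemma kappa_root: "2 * (kappa - 1) ^ 3 - 2 * (kappa - 1) - 1 = 0"
proof -
  define z where "z = psi - 1"
  have z: "z > 0" "z ^ 3 + 2 * z ^ 2 - 2 = 0"
    using psi_gt_1 psi_root by (auto simp: z_def power2_eq_square power3_eq_cube algebra_simps)
  have "2 * (1 / z) ^ 3 - 2 * (1 / z) - 1 = - (z ^ 3 + 2 * z ^ 2 - 2) / z ^ 3"
    using z(1) by (simp add: field_simps power2_eq_square power3_eq_cube)
  then show ?thesis using z(2) by (simp add: kappa_def z_def)
qed

lemma kappa_gt_1: "kappa > 1"
  using psi_gt_1 by (simp add: kappa_def)

lemma kappa_bounds: "2.19148788395 \<le> kappa" "kappa < 2.19148788396"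
proof -
  \<comment> \<open>The cubic of \<open>kappa_root\<close>. It increases on [1, infinity), so its
    signs at the two decimal bounds locate the root \<open>kappa - 1\<close> once this is known to
    exceed 1.\<close>
  define f where "f y = 2 * y ^ 3 - 2 * y - (1::real)" for y
  have mono: "f y < f x" if "1 \<le> y" "y < x" for x y
  proof -
    have eq: "f x - f y = 2 * (x - y) * (x * x + x * y + y * y - 1)"
      by (simp add: f_def power3_eq_cube algebra_simps)
    have "1 * 1 \<le> y * y" using that(1) by (intro mult_mono) auto
    moreover have "0 \<le> x * x" "0 < x * y" using that by auto
    ultimately have "0 < x * x + x * y + y * y - 1" by linarith
    with eq have "0 < f x - f y" using that by simp
    then show ?thesis by simp
  qed
  have root: "f (kappa - 1) = 0" using kappa_root by (simp add: f_def)
  have gt: "kappa - 1 > 1"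
  proof (rule ccontr)
    assume "\<not> kappa - 1 > 1"
    then have "(kappa - 1) ^ 3 \<le> (kappa - 1) ^ 1"
      using kappa_gt_1 by (intro power_decreasing) auto
    with root show False by (simp add: f_def)
  qed
  show "2.19148788395 \<le> kappa"
  proof (rule ccontr)
    assume "\<not> ?thesis"
    then have "f (kappa - 1) < f 1.19148788395" using gt by (intro mono) auto
    moreover have "f 1.19148788395 < 0" by (simp add: f_def power3_eq_cube)
    ultimately show False using root by simp
  qed
  show "kappa < 2.19148788396"
  proof (rule ccontr)
    assume "\<not> ?thesis"
    then have "1.19148788396 = kappa - 1 \<or> 1.19148788396 < kappa - 1" by auto
    then have "f 1.19148788396 \<le> f (kappa - 1)"
    proof
      assume "1.19148788396 < kappa - 1"
      then show ?thesis using mono[of "1.19148788396" "kappa - 1"] by simp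
    qed (simp only: order_refl)
    moreover have "f 1.19148788396 > 0" by (simp add: f_def power3_eq_cube)
    ultimately show False using root by simp
  qed
qed

lemma psi_bounds: "1.839 < psi" "psi < 1.8395"
proof -
  have z: "(psi - 1) * (kappa - 1) = 1" using psi_gt_1 by (simp add: kappa_def)
  have "1.839 < psi \<and> psi < 1.8395"
  proof (intro conjI; rule ccontr)
    assume "\<not> 1.839 < psi"
    then have "(psi - 1) * (kappa - 1) \<le> 0.839 * 1.19148788396"
      using psi_gt_1 kappa_bounds by (intro mult_mono) auto
    with z show False by simp
  next
    assume "\<not> psi < 1.8395"
    then have "0.8395 * 1.19148788395 \<le> (psi - 1) * (kappa - 1)"
      using psi_gt_1 kappa_bounds by (intro mult_mono) auto
    with z show False by simp
  qed
  then show "1.839 < psi" "psi < 1.8395" by auto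
qed

section \<open>Partial sums of Tribonacci numbers against their limit ratio\<close>

definition trib_defect :: "nat \<Rightarrow> real" where
  "trib_defect n = trib n - (psi - 1) * trib_sum n"

text \<open>The factor psi - 1 cancels the component of \<open>trib\<close> that grows like psi^n. A
  constant and the components of the two conjugate roots remain, so psi times X^2 + (psi - 1) X +
  1/psi, the cofactor of X - psi in X^3 - X^2 - X - 1, sends the defect to a constant.\<close>

lemma trib_defect_rec:
  "psi * trib_defect (Suc (Suc n)) + psi * (psi - 1) * trib_defect (Suc n) + trib_defect n
     = 2 * psi"
proof (induction n)
  case 0
  then show ?case using psi_root
    by (simp add: trib_defect_def trib_sum_def power2_eq_square power3_eq_cube algebra_simps)
next
  case (Suc n)
  have "psi * trib_defect (Suc (Suc (Suc n))) + psi * (psi - 1) * trib_defect (Suc (Suc n))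
          + trib_defect (Suc n)
      - (psi * trib_defect (Suc (Suc n)) + psi * (psi - 1) * trib_defect (Suc n) + trib_defect n)
      = - (psi ^ 3 - psi ^ 2 - psi - 1) * trib (Suc n)"
    by (simp add: trib_defect_def power2_eq_square power3_eq_cube algebra_simps)
  then show ?case using Suc psi_root by simp
qed

text \<open>The deviations from the fixed point \<open>psi - 1\<close> of the recurrence satisfy a homogeneous
  recurrence whose characteristic roots are complex conjugates with product \<open>1 / psi\<close>, so this definite
  quadratic form in two consecutive deviations shrinks by that factor at each step.\<close>

lemma trib_defect_form:
  defines "x \<equiv> \<lambda>n. trib_defect n - (psi - 1)"
  shows "psi * x (Suc n) ^ 2 + psi * (psi - 1) * x (Suc n) * x n + x n ^ 2 \<le> 0.3"
proof (induction n)
  case 0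
  have x: "x 0 = 2 - psi" "x (Suc 0) = 4 - 2 * psi"
    by (auto simp: x_def trib_defect_def trib_sum_def)
  have "psi * x (Suc 0) ^ 2 + psi * (psi - 1) * x (Suc 0) * x 0 + x 0 ^ 2
     = (2 - psi) ^ 2 * (2 * psi ^ 2 + 2 * psi + 1)"
    by (simp add: x power2_eq_square algebra_simps)
  also have "\<dots> \<le> 0.161 ^ 2 * (2 * 1.8395 ^ 2 + 2 * 1.8395 + 1)"
    using psi_bounds psi_gt_1 by (intro mult_mono add_mono power_mono) auto
  also have "\<dots> \<le> 0.3" by (simp add: power2_eq_square)
  finally show ?case .
next
  case (Suc n)
  let ?q = "\<lambda>n. psi * x (Suc n) ^ 2 + psi * (psi - 1) * x (Suc n) * x n + x n ^ 2"
  \<comment> \<open>The coefficients in \<open>trib_defect_rec\<close> add up to psi^2 + 1, so this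
    identity makes psi - 1 its fixed point.\<close>
  have "(psi - 1) * (psi ^ 2 + 1) = 2 * psi + (psi ^ 3 - psi ^ 2 - psi - 1)"
    by (simp add: power2_eq_square power3_eq_cube algebra_simps)
  then have "(psi - 1) * (psi ^ 2 + 1) = 2 * psi" using psi_root by simp
  then have rec: "psi * x (Suc (Suc n)) = - (psi * (psi - 1) * x (Suc n) + x n)"
    using trib_defect_rec[of n] by (simp add: x_def power2_eq_square algebra_simps)
  have "psi * ?q (Suc n) = (psi * x (Suc (Suc n))) ^ 2
     + psi * (psi - 1) * x (Suc n) * (psi * x (Suc (Suc n))) + psi * x (Suc n) ^ 2"
    by (simp add: power2_eq_square algebra_simps)
  also have "\<dots> = ?q n"
    unfolding rec by (simp add: power2_eq_square algebra_simps)
  finally have eq: "psi * ?q (Suc n) = ?q n" .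
  show ?case
  proof (rule ccontr)
    assume "\<not> ?case"
    then have "1 * 0.3 < psi * ?q (Suc n)" using psi_gt_1 by (intro mult_strict_mono) auto
    with eq Suc show False by simp
  qed
qed

lemma trib_defect_bounds: "0 \<le> trib_defect n" "trib_defect n \<le> 2"
proof -
  define x y where "x = trib_defect n - (psi - 1)" "y = trib_defect (Suc n) - (psi - 1)"
  have q: "psi * y ^ 2 + psi * (psi - 1) * y * x + x ^ 2 \<le> 0.3"
    using trib_defect_form[of n] by (simp add: x_y_def)
  \<comment> \<open>Completing the square bounds \<open>x\<close> alone. The radius 0.8 stays below
    psi - 1 > 0.839, which is what makes the defect nonnegative.\<close>
  have "psi * y ^ 2 + psi * (psi - 1) * y * x + x ^ 2
      = psi * (y + (psi - 1) / 2 * x) ^ 2 + (1 - psi * (psi - 1) ^ 2 / 4) * x ^ 2"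
    by (simp add: power2_eq_square field_simps)
  moreover have "0 \<le> psi * (y + (psi - 1) / 2 * x) ^ 2" using psi_gt_1 by simp
  moreover have "psi * (psi - 1) ^ 2 \<le> 1.8395 * 0.8395 ^ 2"
    using psi_bounds psi_gt_1 by (intro mult_mono power_mono) auto
  then have "(1 - psi * (psi - 1) ^ 2 / 4) * x ^ 2 \<ge> 0.6 * x ^ 2"
    by (intro mult_right_mono) (auto simp: power2_eq_square)
  ultimately have "0.6 * x ^ 2 \<le> 0.3" using q by linarith
  then have "x ^ 2 \<le> 0.8 ^ 2" by (simp add: power2_eq_square)
  then have "\<bar>x\<bar> \<le> 0.8" by (simp only: abs_le_square_iff[symmetric])
  then have "- 0.8 \<le> x" "x \<le> 0.8" by auto
  then show "0 \<le> trib_defect n" "trib_defect n \<le> 2"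
    using psi_bounds by (simp_all add: x_y_def)
qed

lemma kappa_trib:
  "kappa * trib n - trib_sum (Suc n) = (kappa - 1) * trib_defect n"
  using psi_gt_1 by (simp add: kappa_def trib_defect_def field_simps)

lemma trib_sum_le: "trib_sum (Suc n) \<le> kappa * trib n"
  using kappa_trib[of n] trib_defect_bounds[of n] kappa_gt_1 mult_nonneg_nonneg[of "kappa - 1"]
  by (smt (verit))

lemma trib_sum_ge: "kappa * trib n - 3 \<le> trib_sum (Suc n)"
proof -
  have "(kappa - 1) * trib_defect n \<le> 1.2 * 2"
    using trib_defect_bounds kappa_bounds by (intro mult_mono) auto
  then show ?thesis using kappa_trib[of n] by simp
qed


section \<open>The Tribonacci word\<close>

datatype letter = A | B | C

fun trib_image :: "letter \<Rightarrow> letter list" where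
  "trib_image A = [A, B]"
| "trib_image B = [A, C]"
| "trib_image C = [A]"

definition tau :: "letter list \<Rightarrow> letter list" where
  "tau w = concat (map trib_image w)"

text \<open>A diagonal reading: the iterates of A are prefixes of one another, and the n-th is
  longer than n, so the index is in range.\<close>

definition tribonacci :: "letter word" where
  "tribonacci n = (tau ^^ n) [A] ! n"

definition starts_with :: "'a word \<Rightarrow> 'a list \<Rightarrow> bool" where
  "starts_with x w \<longleftrightarrow> (\<forall>k<length w. x k = w ! k)"

lemma starts_with_appendD: "starts_with x (u @ v) \<Longrightarrow> starts_with x u"
  by (auto simp: starts_with_def nth_append)

lemma starts_with_subsequence: "x [0 \<rightarrow> length w] = w \<Longrightarrow> starts_with x w"
  unfolding starts_with_def by (metis add_0 subsequence_nth diff_zero)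

lemma starts_with_take: "starts_with x w \<Longrightarrow> k \<le> length w \<Longrightarrow> x [0 \<rightarrow> k] = take k w"
  by (auto simp: starts_with_def intro!: nth_equalityI)

lemma tau_append [simp]: "tau (u @ v) = tau u @ tau v"
  by (simp add: tau_def)

lemma tau_pow_append: "(tau ^^ n) (u @ v) = (tau ^^ n) u @ (tau ^^ n) v"
  by (induction n) auto

lemma tau_pow_Suc_A: "(tau ^^ Suc n) [A] = (tau ^^ n) [A] @ (tau ^^ n) [B]"
  using tau_pow_append[of n "[A]" "[B]"] by (simp add: funpow_swap1 tau_def)

lemma tau_pow_nonempty: "w \<noteq> [] \<Longrightarrow> (tau ^^ n) w \<noteq> []"
proof (induction n)
  case (Suc n)
  then obtain a v where "(tau ^^ n) w = a # v" by (cases "(tau ^^ n) w") auto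
  then have "(tau ^^ Suc n) w = trib_image a @ tau v" by (simp add: tau_def)
  then show ?case by (cases a) auto
qed simp

lemma length_tau_pow: "n < length ((tau ^^ n) [A])"
proof (induction n)
  case (Suc n)
  moreover have "0 < length ((tau ^^ n) [B])" using tau_pow_nonempty[of "[B]" n] by simp
  ultimately show ?case unfolding tau_pow_Suc_A by (simp del: length_greater_0_conv)
qed simp

lemma tau_pow_prefix: "m \<le> n \<Longrightarrow> \<exists>z. (tau ^^ n) [A] = (tau ^^ m) [A] @ z"
  by (induction n rule: dec_induct) (auto simp: tau_pow_Suc_A simp del: funpow.simps(2))

lemma starts_with_tau_pow: "starts_with tribonacci ((tau ^^ n) [A])"
  unfolding starts_with_def tribonacci_def
proof (intro allI impI)
  fix k assume k: "k < length ((tau ^^ n) [A])"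
  show "(tau ^^ k) [A] ! k = (tau ^^ n) [A] ! k"
  proof (cases "k \<le> n")
    case True
    then show ?thesis using tau_pow_prefix[of k n] length_tau_pow[of k] by (auto simp: nth_append)
  next
    case False
    then show ?thesis using tau_pow_prefix[of n k] k by (auto simp: nth_append)
  qed
qed

lemma tribonacci_prefix: "\<exists>z. (tau ^^ k) [A] = tribonacci [0 \<rightarrow> k] @ z"
  using starts_with_take[OF starts_with_tau_pow[of k], of k] length_tau_pow[of k]
  by (metis append_take_drop_id less_imp_le)

lemma starts_with_tau: "starts_with tribonacci (tau (tribonacci [0 \<rightarrow> k]))"
proof -
  obtain z where "(tau ^^ k) [A] = tribonacci [0 \<rightarrow> k] @ z" using tribonacci_prefix by blast
  then have "(tau ^^ Suc k) [A] = tau (tribonacci [0 \<rightarrow> k]) @ tau z" by simp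
  then show ?thesis using starts_with_tau_pow[of "Suc k"] by (metis starts_with_appendD)
qed

text \<open>Serves both codings: \<open>tau\<close> with empty \<open>v\<close>, and
  \<open>kimb_image\<close> with \<open>v\<close> the initial 0.\<close>

lemma starts_with_morphism_nth:
  assumes "starts_with y (v @ concat (map f (x [0 \<rightarrow> Suc k])))" and "j < length (f (x k))"
  shows "y (length v + (\<Sum>q<k. length (f (x q))) + j) = f (x k) ! j"
proof -
  have len: "length (concat (map f (x [0 \<rightarrow> k]))) = (\<Sum>q<k. length (f (x q)))" for k
    by (induction k) (auto simp: subsequence_def)
  have "v @ concat (map f (x [0 \<rightarrow> Suc k])) = (v @ concat (map f (x [0 \<rightarrow> k]))) @ f (x k)"
    by (simp add: subsequence_def)
  then show ?thesis using assms unfolding starts_with_def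
    by (metis (no_types, lifting) len length_append nat_add_left_cancel_less nth_append_length_plus)
qed

text \<open>Where the image of letter \<open>k\<close> starts in t = tau(t). These are exactly the
  positions of A, since A opens every image and occurs nowhere else in one.\<close>

definition tau_pos :: "nat \<Rightarrow> nat" where
  "tau_pos k = (\<Sum>q<k. length (trib_image (tribonacci q)))"

lemma tau_pos_0 [simp]: "tau_pos 0 = 0"
  by (simp add: tau_pos_def)

lemma tau_pos_Suc: "tau_pos (Suc k) = tau_pos k + length (trib_image (tribonacci k))"
  by (simp add: tau_pos_def)

lemma tribonacci_tau_pos_add:
  "j < length (trib_image (tribonacci k)) \<Longrightarrow>
     tribonacci (tau_pos k + j) = trib_image (tribonacci k) ! j"
  using starts_with_morphism_nth[of tribonacci "[]" trib_image tribonacci k j]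
    starts_with_tau[of "Suc k"]
  by (simp add: tau_def tau_pos_def)

lemma tribonacci_tau_pos [simp]: "tribonacci (tau_pos k) = A"
  using tribonacci_tau_pos_add[of 0 k] by (cases "tribonacci k") auto

lemma tribonacci_0 [simp]: "tribonacci 0 = A"
  using tribonacci_tau_pos[of 0] by simp

text \<open>One cyclic permutation decodes \<open>tau\<close> from both sides: it gives the letter
  after the start of an image (for C, the A of the next image) and also the last letter of an
  image.\<close>

fun next_letter :: "letter \<Rightarrow> letter" where
  "next_letter A = B"
| "next_letter B = C"
| "next_letter C = A"

lemma next_letter_eq_iff [simp]: "next_letter a = next_letter b \<longleftrightarrow> a = b"
  by (cases a; cases b) auto

lemma tribonacci_tau_pos_1: "tribonacci (tau_pos k + 1) = next_letter (tribonacci k)"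
  using tribonacci_tau_pos_add[of 1 k] tribonacci_tau_pos[of "Suc k"]
  by (cases "tribonacci k") (auto simp: tau_pos_Suc)

lemma tribonacci_before_tau_pos:
  "tribonacci (tau_pos (Suc k) - 1) = next_letter (tribonacci k)"
  using tribonacci_tau_pos_1[of k] tribonacci_tau_pos[of k]
  by (cases "tribonacci k") (auto simp: tau_pos_Suc)

lemma tau_pos_less_Suc: "tau_pos k < tau_pos (Suc k)"
  by (cases "tribonacci k") (auto simp: tau_pos_Suc)

lemma strict_mono_tau_pos: "strict_mono tau_pos"
  by (simp add: strict_mono_Suc_iff tau_pos_less_Suc)

lemma tau_pos_Suc_gt: "Suc k < tau_pos (Suc k)"
proof (induction k)
  case 0
  then show ?case by (simp add: tau_pos_Suc)
next
  case (Suc k)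
  then show ?case using tau_pos_less_Suc[of "Suc k"] by simp
qed

lemma tribonacci_position_cases:
  obtains k where "n = tau_pos k" "tribonacci n = A"
  | k where "n = tau_pos k + 1" "Suc n = tau_pos (Suc k)" "tribonacci n \<noteq> A"
proof -
  have "\<exists>k. n = tau_pos k \<or> (n = tau_pos k + 1 \<and> tribonacci k \<noteq> C)"
  proof (induction n)
    case 0
    then show ?case by (intro exI[of _ 0]) auto
  next
    case (Suc n)
    then obtain k where "n = tau_pos k \<or> (n = tau_pos k + 1 \<and> tribonacci k \<noteq> C)" by blast
    then show ?case
      using tau_pos_Suc[of k]
      by (intro exI[of _ "if n = tau_pos k \<and> tribonacci k \<noteq> C then k else Suc k"])
         (cases "tribonacci k"; auto)
  qed
  then obtain k where "n = tau_pos k \<or> (n = tau_pos k + 1 \<and> tribonacci k \<noteq> C)" by blast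
  then show ?thesis
  proof
    assume "n = tau_pos k"
    then show ?thesis using that(1)[of k] by simp
  next
    assume "n = tau_pos k + 1 \<and> tribonacci k \<noteq> C"
    then show ?thesis using that(2)[of k] tribonacci_tau_pos_1[of k] tau_pos_Suc[of k]
      by (cases "tribonacci k") auto
  qed
qed

lemma tribonacci_eq_A: "tribonacci n = A \<Longrightarrow> \<exists>k. n = tau_pos k"
  by (rule tribonacci_position_cases[of n]) auto

lemma tribonacci_Suc_eq_A: "tribonacci n \<noteq> A \<Longrightarrow> tribonacci (Suc n) = A"
  by (rule tribonacci_position_cases[of n]) auto


section \<open>Lengths of iterated images\<close>

text \<open>The weight of a letter is the length of its image under the \<open>n\<close>-th power of \<open>tau\<close>, followed by
  the coding \<open>kimb_image\<close> below.\<close>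

fun weight :: "nat \<Rightarrow> letter \<Rightarrow> nat" where
  "weight n A = trib (n + 2)"
| "weight n B = trib (n + 1) + trib n"
| "weight n C = trib (n + 1)"

lemma weight_ge: "trib (n + 1) \<le> weight n a"
  using trib_mono_Suc[of "n + 1"] by (cases a) auto

lemma weight_ge_not_C: "a \<noteq> C \<Longrightarrow> trib (n + 1) + trib n \<le> weight n a"
  using trib_Suc2_ge[of n] by (cases a) auto

lemma sum_list_weight_trib_image: "sum_list (map (weight n) (trib_image a)) = weight (Suc n) a"
  by (cases a) auto

definition weight_sum :: "nat \<Rightarrow> nat \<Rightarrow> nat" where
  "weight_sum n k = (\<Sum>q<k. weight n (tribonacci q))"

lemma weight_sum_0 [simp]: "weight_sum n 0 = 0"
  by (simp add: weight_sum_def)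

lemma weight_sum_Suc: "weight_sum n (Suc k) = weight_sum n k + weight n (tribonacci k)"
  by (simp add: weight_sum_def)

lemma weight_sum_mono: "j \<le> k \<Longrightarrow> weight_sum n j \<le> weight_sum n k"
  unfolding weight_sum_def by (intro sum_mono2) auto

text \<open>Descending through \<open>tau\<close> raises the level of the weights by one, so the
  coded lengths being compared stay the same.\<close>

lemma weight_sum_tau_pos: "weight_sum n (tau_pos k) = weight_sum (Suc n) k"
proof (induction k)
  case (Suc k)
  have "weight_sum n (tau_pos k + m) = weight_sum n (tau_pos k)
          + sum_list (map (weight n) (take m (trib_image (tribonacci k))))"
    if "m \<le> length (trib_image (tribonacci k))" for m
    using that
    by (induction m) (auto simp: weight_sum_Suc tribonacci_tau_pos_add take_Suc_conv_app_nth)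
  from this[OF order_refl] Suc show ?case
    by (simp add: tau_pos_Suc sum_list_weight_trib_image weight_sum_Suc)
qed simp


section \<open>Repetitions in the Tribonacci word\<close>

text \<open>Both positions are kept rather than the shift alone, because a descent through
  \<open>tau_pos\<close> acts on each position separately.\<close>

definition matches :: "'a word \<Rightarrow> nat \<Rightarrow> nat \<Rightarrow> nat \<Rightarrow> bool" where
  "matches x i j e \<longleftrightarrow> (\<forall>k<e. x (i + k) = x (j + k))"

lemma matchesD: "matches x i j e \<Longrightarrow> k < e \<Longrightarrow> x (i + k) = x (j + k)"
  by (simp add: matches_def)

lemma matches_Suc: "matches x i j (Suc e) \<longleftrightarrow> matches x i j e \<and> x (i + e) = x (j + e)"
  by (auto simp: matches_def less_Suc_eq)

lemma matches_Suc_left: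
  "matches x i j (Suc e) \<longleftrightarrow> x i = x j \<and> matches x (Suc i) (Suc j) e"
  by (auto simp: matches_def less_Suc_eq_0_disj)

lemma tau_pos_matches:
  "matches tribonacci a b d \<Longrightarrow> tau_pos (a + d) + tau_pos b = tau_pos (b + d) + tau_pos a"
  by (induction d) (auto simp: matches_Suc tau_pos_Suc)

text \<open>Position \<open>i + e\<close> is the last of the match. Since it holds A, the letter
  after every earlier block start still lies inside the match and decodes that block. The block
  opened by the final A may stay undetermined, so its letter is left out of the preimage.\<close>

lemma tribonacci_desubstitute:
  assumes m: "matches tribonacci i j (Suc e)" and "i < j"
    and A: "tribonacci i = A" "tribonacci (i + e) = A"
  obtains a b d where "i = tau_pos a" "j = tau_pos b" "i + e = tau_pos (a + d)"
    "j + e = tau_pos (b + d)" "matches tribonacci a b d" "a < b"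
proof -
  have "tribonacci j = A" using matchesD[OF m, of 0] A by simp
  then obtain a b z where abz: "i = tau_pos a" "j = tau_pos b" "i + e = tau_pos z"
    using tribonacci_eq_A A by metis
  have "a < b" using \<open>i < j\<close> abz strict_mono_less[OF strict_mono_tau_pos] by simp
  have "tau_pos a \<le> tau_pos z" using abz by linarith
  then have "a \<le> z" by (simp add: strict_mono_less_eq[OF strict_mono_tau_pos])
  define d where "d = z - a"
  have matched: "matches tribonacci a b k" if "k \<le> d" for k
    using that
  proof (induction k)
    case (Suc k)
    then have "matches tribonacci a b k" by simp
    note shift = tau_pos_matches[OF this]
    have "a \<le> a + k" by simp
    then have "tau_pos a \<le> tau_pos (a + k)"
      by (simp add: strict_mono_less_eq[OF strict_mono_tau_pos])
    moreover have "a + k < z" using Suc.prems by (simp add: d_def)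
    then have "tau_pos (a + k) < tau_pos z"
      by (simp add: strict_mono_less[OF strict_mono_tau_pos])
    ultimately have k': "tau_pos (a + k) - i + 1 < Suc e" "i \<le> tau_pos (a + k)"
      using abz by auto
    have "tribonacci (tau_pos (a + k) + 1) = tribonacci (tau_pos (b + k) + 1)"
      using matchesD[OF m k'(1)] k'(2) shift abz by (simp add: algebra_simps)
    then have "tribonacci (a + k) = tribonacci (b + k)" unfolding tribonacci_tau_pos_1 by simp
    with Suc show ?case by (simp add: matches_Suc)
  qed (simp add: matches_def)
  have "i + e = tau_pos (a + d)" using abz \<open>a \<le> z\<close> by (simp add: d_def)
  moreover from this have "j + e = tau_pos (b + d)"
    using tau_pos_matches[OF matched[OF order_refl]] abz by simp
  ultimately show ?thesis using that abz matched[OF order_refl] \<open>a < b\<close> by blast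
qed

lemma weight_sum_less:
  assumes "i < j"
  shows "weight_sum n i + trib (n + 1) \<le> weight_sum n j"
proof -
  have "weight_sum n (Suc i) \<le> weight_sum n j" using assms by (intro weight_sum_mono) simp
  then show ?thesis using weight_ge[of n "tribonacci i"] by (simp add: weight_sum_Suc)
qed

text \<open>The neighbours of a letter other than A are A, so a match beginning or ending with such
  a letter extends there. Moving left adds and drops an A in the period word, which keeps its
  weight. The bound on \<open>j' + e'\<close> serves the induction measure.\<close>

lemma extend_match_to_A:
  assumes m: "matches tribonacci i j e" and "e > 0" "i < j"
  obtains i' j' e' where "matches tribonacci i' j' (Suc e')" "i' < j'"
    "tribonacci i' = A" "tribonacci (i' + e') = A"
    "i' \<le> i" "i + e \<le> i' + Suc e'" "j' + e' \<le> j + e"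
    "\<And>n. weight_sum n j' + weight_sum n i = weight_sum n j + weight_sum n i'"
proof -
  obtain f where e: "e = Suc f" using \<open>e > 0\<close> by (cases e) auto
  have "\<exists>i' j' e'. matches tribonacci i' j' (Suc e') \<and> i' < j' \<and> tribonacci i' = A
     \<and> i' \<le> i \<and> i' + e' = i + f \<and> j' + e' = j + f
     \<and> (\<forall>n. weight_sum n j' + weight_sum n i = weight_sum n j + weight_sum n i')"
  proof (cases "tribonacci i = A")
    case True
    then show ?thesis using m e \<open>i < j\<close> by blast
  next
    case False
    then obtain i' where i: "i = Suc i'" by (cases i) auto
    obtain j' where j: "j = Suc j'" using \<open>i < j\<close> by (cases j) auto
    have "tribonacci j \<noteq> A" using False matchesD[OF m, of 0] e by simp
    then have "tribonacci i' = A" "tribonacci j' = A"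
      using False tribonacci_Suc_eq_A i j by blast+
    then show ?thesis using m i j e \<open>i < j\<close>
      by (intro exI[of _ i'] exI[of _ j'] exI[of _ "Suc f"])
         (auto simp: matches_Suc_left weight_sum_Suc)
  qed
  then obtain i' j' e' where 1: "matches tribonacci i' j' (Suc e')" "i' < j'"
    "tribonacci i' = A" "i' \<le> i" "i' + e' = i + f" "j' + e' = j + f"
    "\<And>n. weight_sum n j' + weight_sum n i = weight_sum n j + weight_sum n i'"
    by blast
  show ?thesis
  proof (cases "tribonacci (i' + e') = A")
    case True
    then show ?thesis using 1 e by (intro that[of i' j' e']) auto
  next
    case False
    then have "tribonacci (j' + e') \<noteq> A" using matchesD[OF 1(1), of e'] by simp
    then have "tribonacci (i' + Suc e') = A" "tribonacci (j' + Suc e') = A"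
      using False tribonacci_Suc_eq_A by auto
    then show ?thesis using 1 e
      by (intro that[of i' j' "Suc e'"]) (auto simp: matches_Suc)
  qed
qed

lemma tau_pos_gt: "0 < k \<Longrightarrow> k < tau_pos k"
  using tau_pos_Suc_gt by (cases k) auto

text \<open>\<open>trib_sum (n + 2)\<close> is 3, for loose bits at the ends of the coded match,
  plus the lengths of the A's gained on the \<open>n\<close> levels already descended. Each descent
  moves the final A of the match into this sum. At an empty match the period weighs at least
  \<open>trib (n + 1)\<close>, the weight of C.\<close>

lemma tribonacci_match_bound:
  assumes "matches tribonacci i j e" "i < j"
  shows "weight_sum n (i + e) + trib_sum (n + 2)
    \<le> weight_sum n i + kappa * (real (weight_sum n j) - weight_sum n i)"
  using assms
proof (induction "j + e" arbitrary: i j e n rule: less_induct)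
  case less
  show ?case
  proof (cases "e = 0")
    case True
    have "real (trib_sum (n + 2)) \<le> kappa * trib (n + 1)"
      using trib_sum_le[of "n + 1"] by simp
    also have "\<dots> \<le> kappa * (real (weight_sum n j) - weight_sum n i)"
      using weight_sum_less[OF \<open>i < j\<close>, of n] kappa_gt_1 by (intro mult_left_mono) auto
    finally show ?thesis using True by simp
  next
    case False
    then obtain i' j' e' where ext: "matches tribonacci i' j' (Suc e')" "i' < j'"
      "tribonacci i' = A" "tribonacci (i' + e') = A"
      "i' \<le> i" "i + e \<le> i' + Suc e'" "j' + e' \<le> j + e"
      "\<And>n. weight_sum n j' + weight_sum n i = weight_sum n j + weight_sum n i'"
      using extend_match_to_A[OF less.prems(1) _ less.prems(2)] by blast
    obtain a b d where abd: "i' = tau_pos a" "j' = tau_pos b" "i' + e' = tau_pos (a + d)"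
      "j' + e' = tau_pos (b + d)" "matches tribonacci a b d" "a < b"
      using tribonacci_desubstitute[OF ext(1-4)] by blast
    have "b + d < j' + e'" using abd tau_pos_gt[of "b + d"] by simp
    then have IH: "weight_sum (Suc n) (a + d) + trib_sum (Suc n + 2)
       \<le> weight_sum (Suc n) a + kappa * (real (weight_sum (Suc n) b) - weight_sum (Suc n) a)"
      using less.hyps[of b d a "Suc n"] abd ext by simp
    have "weight_sum n (i + e) \<le> weight_sum n (i' + Suc e')"
      using ext by (intro weight_sum_mono)
    also have "\<dots> = weight_sum (Suc n) (a + d) + trib (n + 2)"
      using ext(4) by (simp add: weight_sum_Suc abd(3) weight_sum_tau_pos)
    finally have "weight_sum n (i + e) \<le> weight_sum (Suc n) (a + d) + trib (n + 2)" .
    moreover have "weight_sum n i' \<le> weight_sum n i" using ext by (intro weight_sum_mono)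
    moreover have "real (weight_sum n j) - weight_sum n i
        = real (weight_sum (Suc n) b) - weight_sum (Suc n) a"
      using ext(8)[of n] abd by (simp add: weight_sum_tau_pos)
    ultimately show ?thesis using IH abd(1) by (simp add: weight_sum_tau_pos)
  qed
qed

text \<open>A maximal match whose left and right pairs of mismatching letters are different has no single
  letter \<open>C\<close> as its ultimate desubstituted period, which leaves room for one more unit.\<close>

lemma tribonacci_maximal_match_bound:
  assumes "matches tribonacci i j e" "i < j"
    and "tribonacci (i + e) \<noteq> tribonacci (j + e)"
    and "i = 0 \<or> tribonacci (i - 1) \<noteq> tribonacci (j - 1) \<and>
      {tribonacci (i - 1), tribonacci (j - 1)} \<noteq> {tribonacci (i + e), tribonacci (j + e)}"
  shows "weight_sum n (i + e) + trib_sum (n + 2) + 1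
    \<le> weight_sum n i + kappa * (real (weight_sum n j) - weight_sum n i)"
  using assms
proof (induction "j + e" arbitrary: i j e n rule: less_induct)
  case less
  note R = less.prems(3) and L = less.prems(4)
  show ?case
  proof (cases "e = 0")
    case True
    have "weight_sum n i + trib (n + 1) + trib n \<le> weight_sum n j"
    proof (cases "j = Suc i")
      case True
      \<comment> \<open>A C stands between two A's, so with \<open>e = 0\<close> and
        \<open>j = Suc i\<close> the mismatching pairs on the left and on the right would both be
        {A, C}.\<close>
      have "tribonacci i \<noteq> C"
      proof
        assume iC: "tribonacci i = C"
        then have "i \<noteq> 0" by (metis tribonacci_0 letter.distinct(3))
        then obtain h where h: "i = Suc h" by (cases i) auto
        have "tribonacci h = A" "tribonacci (Suc i) = A"
          using iC h tribonacci_Suc_eq_A[of h] tribonacci_Suc_eq_A[of i] by auto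
        then show False using L True \<open>e = 0\<close> iC h by auto
      qed
      then show ?thesis
        using True weight_ge_not_C[of "tribonacci i" n] by (simp add: weight_sum_Suc)
    next
      case False
      then have "Suc i < j" using \<open>i < j\<close> by simp
      then show ?thesis
        using weight_sum_less[of i "Suc i" n] weight_sum_less[of "Suc i" j n] trib_mono_Suc[of n]
        by simp
    qed
    \<comment> \<open>The surplus \<open>trib n\<close> in the period is at least 1, and
      \<open>kappa > 1\<close> turns it into the extra unit.\<close>
    then have "real (trib (n + 1)) + 1 \<le> real (weight_sum n j) - weight_sum n i"
      using trib_gt[of n] by linarith
    then have "kappa * (real (trib (n + 1)) + 1)
        \<le> kappa * (real (weight_sum n j) - weight_sum n i)"
      using kappa_gt_1 by (intro mult_left_mono) auto
    moreover have "real (trib_sum (n + 2)) \<le> kappa * trib (n + 1)"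
      using trib_sum_le[of "n + 1"] by simp
    ultimately show ?thesis using True kappa_gt_1 by (simp add: algebra_simps)
  next
    case False
    then obtain f where e: "e = Suc f" by (cases e) auto
    \<comment> \<open>Maximality forces A at both ends of the match: any other letter there would
      have A as its outer neighbour in both copies, and the match would extend.\<close>
    have iA: "tribonacci i = A"
    proof (rule ccontr)
      assume iA: "tribonacci i \<noteq> A"
      then have "i \<noteq> 0" by (metis tribonacci_0)
      have "tribonacci j \<noteq> A" using iA matchesD[OF less.prems(1), of 0] e by simp
      with iA have "tribonacci (i - 1) = A" "tribonacci (j - 1) = A"
        using tribonacci_Suc_eq_A[of "i - 1"] tribonacci_Suc_eq_A[of "j - 1"] \<open>i \<noteq> 0\<close> \<open>i < j\<close>
        by auto
      then show False using L \<open>i \<noteq> 0\<close> by simp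
    qed
    have fA: "tribonacci (i + f) = A"
    proof (rule ccontr)
      assume "tribonacci (i + f) \<noteq> A"
      then show False
        using R e matchesD[OF less.prems(1), of f] tribonacci_Suc_eq_A[of "i + f"]
          tribonacci_Suc_eq_A[of "j + f"] by auto
    qed
    obtain a b d where abd: "i = tau_pos a" "j = tau_pos b" "i + f = tau_pos (a + d)"
      "j + f = tau_pos (b + d)" "matches tribonacci a b d" "a < b"
      using tribonacci_desubstitute[OF less.prems(1)[unfolded e] less.prems(2) iA fA] by blast
    have R': "tribonacci (i + e) = next_letter (tribonacci (a + d))"
      "tribonacci (j + e) = next_letter (tribonacci (b + d))"
      using tribonacci_tau_pos_1[of "a + d"] tribonacci_tau_pos_1[of "b + d"] abd(3,4)[symmetric]
      by (auto simp: e)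
    have L': "a = 0 \<or> tribonacci (a - 1) \<noteq> tribonacci (b - 1) \<and>
      {tribonacci (a - 1), tribonacci (b - 1)} \<noteq> {tribonacci (a + d), tribonacci (b + d)}"
    proof (cases "a = 0")
      case False
      then have a: "i \<noteq> 0" "a = Suc (a - 1)" "b = Suc (b - 1)"
        using abd tau_pos_gt[of a] \<open>a < b\<close> by auto
      have *: "tribonacci (i - 1) = next_letter (tribonacci (a - 1))"
        "tribonacci (j - 1) = next_letter (tribonacci (b - 1))"
        using tribonacci_before_tau_pos[of "a - 1"] tribonacci_before_tau_pos[of "b - 1"] a abd
        by simp_all
      \<comment> \<open>Both mismatching pairs are relabelled by the same permutation, so their
        being different passes to the preimage.\<close>
      have "next_letter ` {tribonacci (a - 1), tribonacci (b - 1)}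
          \<noteq> next_letter ` {tribonacci (a + d), tribonacci (b + d)}"
        using L a(1) R' * by simp
      then show ?thesis using L a(1) * by auto
    qed simp
    have "b + d < j + f" using abd tau_pos_gt[of "b + d"] by simp
    then have IH: "weight_sum (Suc n) (a + d) + trib_sum (Suc n + 2) + 1
       \<le> weight_sum (Suc n) a + kappa * (real (weight_sum (Suc n) b) - weight_sum (Suc n) a)"
      using less.hyps[of b d a "Suc n"] abd R R' L' e by simp
    have "weight_sum n (i + e) = weight_sum (Suc n) (a + d) + trib (n + 2)"
      using fA abd(3) by (simp add: weight_sum_Suc e weight_sum_tau_pos)
    then show ?thesis using IH abd by (simp add: weight_sum_tau_pos)
  qed
qed


section \<open>Kimberling's word as a coding of the Tribonacci word\<close>

fun kimb_image :: "letter \<Rightarrow> bit list" where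
  "kimb_image A = [1, 0, 0]"
| "kimb_image B = [1, 0, 1]"
| "kimb_image C = [1, 0]"

definition kimb_code :: "letter list \<Rightarrow> bit list" where
  "kimb_code w = concat (map kimb_image w)"

lemma kimb_code_simps [simp]:
  "kimb_code [] = []" "kimb_code (a # w) = kimb_image a @ kimb_code w"
  "kimb_code (u @ v) = kimb_code u @ kimb_code v"
  by (auto simp: kimb_code_def)

lemma kimb_code_starts_with_1: "kimb_code w = [] \<or> hd (kimb_code w) = 1"
proof (cases w)
  case (Cons a v)
  then show ?thesis by (cases a) auto
qed simp

text \<open>Every coded letter starts with 1, so no run of zeros crosses a boundary and the step
  acts letter by letter: 100 gives 10 0101, 101 gives 10 0 10, and 10 gives 10 0, the codes of AB,
  AC and A.\<close>

lemma kimb_step_kimb_code: "kimb_step (kimb_code w) = kimb_code (tau w)"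
proof (induction w)
  case (Cons a w)
  then show ?case
    using kimb_code_starts_with_1[of w]
    by (cases a) (auto simp: tau_def kimb_step_0 kimb_step_00)
qed (simp add: tau_def)

text \<open>\<open>kimb 2\<close> splits as 0 100 10. The leading 0 is followed by 1, hence is a
  block of its own that every step fixes.\<close>

lemma kimb_eq_kimb_code: "kimb (n + 2) = 0 # kimb_code ((tau ^^ n) [A, C])"
proof (induction n)
  case 0
  have "kimb 2 = 0 # kimb_code [A, C]" unfolding kimb_small by simp
  then show ?case by (simp add: numeral_2_eq_2 del: kimb.simps)
next
  case (Suc n)
  have "kimb (Suc n + 2) = kimb_step (kimb (n + 2))" by simp
  also have "\<dots> = 0 # kimb_code ((tau ^^ Suc n) [A, C])"
    unfolding Suc using kimb_code_starts_with_1
    by (simp add: kimb_step_0 kimb_step_kimb_code)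
  finally show ?case .
qed

lemma starts_with_kimb_code: "starts_with kimberling (0 # kimb_code (tribonacci [0 \<rightarrow> k]))"
proof -
  obtain z where z: "(tau ^^ k) [A] = tribonacci [0 \<rightarrow> k] @ z" using tribonacci_prefix by blast
  have "has_kimb_prefixes kimberling"
    unfolding kimberling_def by (rule theI'[OF ex1_has_kimb_prefixes])
  then have "starts_with kimberling (kimb (k + 2))"
    unfolding has_kimb_prefixes_def by (intro starts_with_subsequence) (simp del: kimb.simps)
  also have "kimb (k + 2)
      = (0 # kimb_code (tribonacci [0 \<rightarrow> k])) @ kimb_code (z @ (tau ^^ k) [C])"
    unfolding kimb_eq_kimb_code using tau_pow_append[of k "[A]" "[C]"] z by simp
  finally show ?thesis by (rule starts_with_appendD)
qed

lemma length_kimb_image: "length (kimb_image a) = weight 0 a"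
  by (cases a) (auto simp: numeral_2_eq_2)

definition kimb_pos :: "nat \<Rightarrow> nat" where
  "kimb_pos k = Suc (weight_sum 0 k)"

lemma kimberling_0 [simp]: "kimberling 0 = 0"
  using starts_with_kimb_code[of 0] by (simp add: starts_with_def)

lemma kimberling_kimb_pos_add:
  "j < length (kimb_image (tribonacci k)) \<Longrightarrow>
     kimberling (kimb_pos k + j) = kimb_image (tribonacci k) ! j"
  using starts_with_morphism_nth[of kimberling "[0]" kimb_image tribonacci k j]
    starts_with_kimb_code[of "Suc k"]
  by (simp add: kimb_code_def kimb_pos_def weight_sum_def length_kimb_image)

lemma kimb_pos_0 [simp]: "kimb_pos 0 = Suc 0"
  by (simp add: kimb_pos_def)

lemma kimb_pos_Suc: "kimb_pos (Suc k) = kimb_pos k + length (kimb_image (tribonacci k))"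
  by (simp add: kimb_pos_def weight_sum_Suc length_kimb_image)

lemma kimberling_kimb_pos [simp]:
  "kimberling (kimb_pos k) = 1" "kimberling (Suc (kimb_pos k)) = 0"
  using kimberling_kimb_pos_add[of 0 k] kimberling_kimb_pos_add[of 1 k]
  by (cases "tribonacci k"; simp)+

text \<open>The bits at offsets 2 and 3 are 01, 11, 10 for A, B, C. Together they determine the
  letter, while the first alone confuses B with C; different letters thus agree on at most 3 bits
  forwards.\<close>

lemma kimberling_kimb_pos_2:
  "kimberling (kimb_pos k + 2) = (if tribonacci k = A then 0 else 1)"
  using kimberling_kimb_pos_add[of 2 k] kimberling_kimb_pos(1)[of "Suc k"] kimb_pos_Suc[of k]
  by (cases "tribonacci k") auto

lemma kimberling_kimb_pos_3:
  "kimberling (kimb_pos k + 3) = (if tribonacci k = C then 0 else 1)"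
  using kimberling_kimb_pos[of "Suc k"] kimb_pos_Suc[of k]
  by (cases "tribonacci k") (auto simp: numeral_3_eq_3)

text \<open>Backwards, the last bit confuses only A with C, and the bit before it separates these;
  different letters agree on at most 1 bit.\<close>

lemma kimberling_before_kimb_pos_1:
  "kimberling (kimb_pos (Suc k) - 1) = (if tribonacci k = B then 1 else 0)"
  using kimberling_kimb_pos_add[of 2 k] kimberling_kimb_pos(2)[of k] kimb_pos_Suc[of k]
  by (cases "tribonacci k") (auto simp: numeral_2_eq_2)

lemma kimberling_before_kimb_pos_2:
  "kimberling (kimb_pos (Suc k) - 2) = (if tribonacci k = C then 1 else 0)"
  using kimberling_kimb_pos(1)[of k] kimberling_kimb_pos(2)[of k] kimb_pos_Suc[of k]
  by (cases "tribonacci k") (auto simp: numeral_2_eq_2)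

lemma kimb_pos_less_Suc: "kimb_pos k + 2 \<le> kimb_pos (Suc k)" "kimb_pos (Suc k) \<le> kimb_pos k + 3"
  by (cases "tribonacci k"; simp add: kimb_pos_Suc)+

lemma strict_mono_kimb_pos: "strict_mono kimb_pos"
  unfolding strict_mono_Suc_iff using kimb_pos_less_Suc(1) by (metis add_lessD1 less_add_same_cancel1
    order_less_le_trans zero_less_numeral)

lemma kimb_pos_matches:
  "matches tribonacci a b d \<Longrightarrow> kimb_pos (a + d) + kimb_pos b = kimb_pos (b + d) + kimb_pos a"
  by (induction d) (auto simp: matches_Suc kimb_pos_Suc)

lemma kimb_pos_interval:
  assumes "0 < n"
  obtains k where "kimb_pos k \<le> n" "n < kimb_pos (Suc k)"
proof -
  have "\<exists>k. kimb_pos k \<le> Suc m \<and> Suc m < kimb_pos (Suc k)" for m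
  proof (induction m)
    case 0
    then show ?case using kimb_pos_less_Suc(1)[of 0] by (intro exI[of _ 0]) auto
  next
    case (Suc m)
    then obtain k where k: "kimb_pos k \<le> Suc m" "Suc m < kimb_pos (Suc k)" by blast
    then show ?case using kimb_pos_less_Suc(1)[of "Suc k"]
      by (intro exI[of _ "if Suc (Suc m) < kimb_pos (Suc k) then k else Suc k"]) auto
  qed
  then show ?thesis using that assms by (metis Suc_pred)
qed

text \<open>The only 1 not opening a code is the third bit of the code of B, and the next code
  begins with 1.\<close>

lemma kimberling_10:
  assumes "kimberling n = 1" "kimberling (Suc n) = 0"
  obtains k where "n = kimb_pos k"
proof -
  have "0 < n" using assms(1) by (cases n) auto
  then obtain k where k: "kimb_pos k \<le> n" "n < kimb_pos (Suc k)" by (rule kimb_pos_interval)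
  then have "n = kimb_pos k \<or> n = Suc (kimb_pos k) \<or> n = kimb_pos k + 2"
    using kimb_pos_less_Suc(2)[of k] by linarith
  moreover have "n \<noteq> Suc (kimb_pos k)" using assms(1) by auto
  moreover have "n \<noteq> kimb_pos k + 2"
  proof
    assume n: "n = kimb_pos k + 2"
    then have "Suc n = kimb_pos k + 3" by simp
    then have "tribonacci k = C"
      using assms(2) kimberling_kimb_pos_3[of k] by (metis zero_neq_one)
    then show False using n k kimb_pos_Suc[of k] by simp
  qed
  ultimately show ?thesis using that by blast
qed


section \<open>Repetitions in Kimberling's word\<close>

text \<open>The complete codes inside the match give a match of t. Of the loose bits at the two
  ends, 3 are paid for by \<open>tribonacci_match_bound\<close> and a fourth by
  \<open>tribonacci_maximal_match_bound\<close>. Where the adjacent letters of t agree, the match of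
  t is extended instead.\<close>

lemma kimberling_match_bound_aligned:
  assumes m: "matches kimberling i j e" and "i < j"
    and a: "i \<le> kimb_pos a" "kimb_pos a \<le> i + 2" "a = 0 \<or> kimb_pos (a - 1) < i"
    and e: "kimb_pos a + 2 \<le> i + e"
  shows "e \<le> kappa * (real j - i)"
proof -
  have eq: "kimberling n = kimberling n'" if "i \<le> n" "n < i + e" "n' + i = n + j" for n n'
  proof -
    have "j + (n - i) = n'" using that by simp
    then show ?thesis using matchesD[OF m, of "n - i"] that by simp
  qed
  define n where "n = kimb_pos a + j - i"
  have "kimberling n = 1" "kimberling (Suc n) = 0"
    using eq[of "kimb_pos a" n] eq[of "Suc (kimb_pos a)" "Suc n"] a e \<open>i < j\<close>
    by (auto simp: n_def)
  then obtain b where "n = kimb_pos b" by (rule kimberling_10)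
  then have b: "kimb_pos b + i = kimb_pos a + j" using \<open>i < j\<close> by (simp add: n_def)
  have "a < b" using b \<open>i < j\<close> strict_mono_less[OF strict_mono_kimb_pos, of a b] by simp
  have "0 < i + e - 2" using e by (simp add: kimb_pos_def)
  \<comment> \<open>\<open>z\<close> is the last code whose opening 10 lies inside the match; the
    earlier letters from \<open>a\<close> on are determined by bits of the match.\<close>
  then obtain z where "kimb_pos z \<le> i + e - 2" "i + e - 2 < kimb_pos (Suc z)"
    by (rule kimb_pos_interval)
  then have z: "kimb_pos z + 2 \<le> i + e" "i + e < kimb_pos (Suc z) + 2"
    using e by auto
  then have "kimb_pos a < kimb_pos (Suc z)" using e by linarith
  then have "a \<le> z" by (simp add: strict_mono_less[OF strict_mono_kimb_pos])
  define d where "d = z - a"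
  have ad: "a + d = z" using \<open>a \<le> z\<close> by (simp add: d_def)
  have matched: "matches tribonacci a b k" if "k \<le> d" for k
    using that
  proof (induction k)
    case (Suc k)
    then have mk: "matches tribonacci a b k" by simp
    have "Suc (a + k) \<le> z" "a \<le> a + k" using Suc.prems ad by auto
    then have "kimb_pos (Suc (a + k)) \<le> kimb_pos z" "kimb_pos a \<le> kimb_pos (a + k)"
      by (simp_all only: strict_mono_less_eq[OF strict_mono_kimb_pos])
    then have le: "kimb_pos (a + k) + 4 \<le> i + e" "i \<le> kimb_pos (a + k)"
      using kimb_pos_less_Suc(1)[of "a + k"] z a by auto
    have "kimberling (kimb_pos (a + k) + 2) = kimberling (kimb_pos (b + k) + 2)"
      "kimberling (kimb_pos (a + k) + 3) = kimberling (kimb_pos (b + k) + 3)"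
      using kimb_pos_matches[OF mk] b le by (auto intro!: eq)
    then have "tribonacci (a + k) = tribonacci (b + k)"
      by (cases "tribonacci (a + k)"; cases "tribonacci (b + k)")
         (auto simp: kimberling_kimb_pos_2 kimberling_kimb_pos_3 simp del: add_2_eq_Suc')
    with mk show ?case by (simp add: matches_Suc)
  qed (simp add: matches_def)
  note md = matched[OF order_refl]
  have shift: "kimb_pos z + kimb_pos b = kimb_pos (b + d) + kimb_pos a"
    using kimb_pos_matches[OF md] ad by simp
  define W where "W = weight_sum 0"
  have pos: "kimb_pos k = Suc (W k)" for k by (simp add: kimb_pos_def W_def)
  have p: "real j - i = real (W b) - W a" using b by (simp add: pos)
  have ts: "trib_sum 2 = 3" by (simp add: trib_sum_def numeral_2_eq_2)
  have bound: "W z + 3 \<le> W a + kappa * (real j - i)"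
    using tribonacci_match_bound[OF md \<open>a < b\<close>, of 0] by (simp add: p ad ts W_def)
  show ?thesis
  proof (cases "tribonacci z = tribonacci (b + d)")
    case True
    then have "matches tribonacci a b (Suc d)" using md ad by (simp add: matches_Suc)
    then have "W (Suc z) + 3 \<le> W a + kappa * (real j - i)"
      using tribonacci_match_bound[of a b "Suc d" 0] \<open>a < b\<close> by (simp add: p ad ts W_def)
    then show ?thesis using z a unfolding pos by linarith
  next
    case right: False
    have r: "i + e \<le> kimb_pos z + 3"
    proof (rule ccontr)
      assume "\<not> ?thesis"
      then have "kimberling (kimb_pos z + 2) = kimberling (kimb_pos (b + d) + 2)"
        "kimberling (kimb_pos z + 3) = kimberling (kimb_pos (b + d) + 3)"
        using shift b a \<open>a \<le> z\<close> strict_mono_less_eq[OF strict_mono_kimb_pos, of a z]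
        by (auto intro!: eq)
      with right show False
        by (cases "tribonacci z"; cases "tribonacci (b + d)")
           (auto simp: kimberling_kimb_pos_2 kimberling_kimb_pos_3 simp del: add_2_eq_Suc')
    qed
    have r3: "{tribonacci z, tribonacci (b + d)} = {B, C}" if "i + e = kimb_pos z + 3"
    proof -
      have "kimberling (kimb_pos z + 2) = kimberling (kimb_pos (b + d) + 2)"
        using that shift b a \<open>a \<le> z\<close> strict_mono_less_eq[OF strict_mono_kimb_pos, of a z]
        by (auto intro!: eq)
      with right show ?thesis
        by (cases "tribonacci z"; cases "tribonacci (b + d)")
           (auto simp: kimberling_kimb_pos_2 simp del: add_2_eq_Suc')
    qed
    show ?thesis
    proof (cases "a = 0")
      case True
      show ?thesis
      proof (cases "kimb_pos a = i \<or> i + e \<le> kimb_pos z + 2")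
        case True
        then show ?thesis using bound r \<open>a = 0\<close> unfolding pos by (auto simp: W_def)
      next
        case False
        \<comment> \<open>Four loose bits, one of them the initial 0 of the word: here the
          alternative \<open>i = 0\<close> of the sharper bound applies.\<close>
        have "W z + 4 \<le> W a + kappa * (real j - i)"
          using tribonacci_maximal_match_bound[OF md \<open>a < b\<close>, of 0, unfolded ad] right \<open>a = 0\<close>
          by (simp add: p ts W_def)
        then show ?thesis using r \<open>a = 0\<close> unfolding pos by (simp add: W_def)
      qed
    next
      case False
      then obtain a' b' where ab: "a = Suc a'" "b = Suc b'" using \<open>a < b\<close>
        by (metis Suc_lessE not0_implies_Suc)
      show ?thesis
      proof (cases "tribonacci a' = tribonacci b'")
        case True
        then have "matches tribonacci a' b' (Suc d)" using md ab by (simp add: matches_Suc_left)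
        then have "W z + 3 \<le> W a' + kappa * (real (W b') - W a')"
          using tribonacci_match_bound[of a' b' "Suc d" 0] \<open>a < b\<close> ab ad by (simp add: ts W_def)
        moreover have "real (W b') - W a' = real j - i"
          using True ab by (simp add: p W_def weight_sum_Suc)
        ultimately show ?thesis using r a(3) ab unfolding pos by simp
      next
        case left: False
        have l: "kimb_pos a \<le> i + 1"
        proof (rule ccontr)
          assume "\<not> ?thesis"
          then have "kimberling (kimb_pos a - 1) = kimberling (kimb_pos b - 1)"
            "kimberling (kimb_pos a - 2) = kimberling (kimb_pos b - 2)"
            using b e \<open>i < j\<close> by (auto intro!: eq)
          with left show False
            unfolding ab kimberling_before_kimb_pos_1 kimberling_before_kimb_pos_2
            by (cases "tribonacci a'"; cases "tribonacci b'") auto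
        qed
        have l1: "{tribonacci a', tribonacci b'} = {A, C}" if "kimb_pos a = i + 1"
        proof -
          have "kimberling (kimb_pos a - 1) = kimberling (kimb_pos b - 1)"
            using b e that \<open>i < j\<close> by (auto intro!: eq)
          with left show ?thesis
            unfolding ab kimberling_before_kimb_pos_1
            by (cases "tribonacci a'"; cases "tribonacci b'") auto
        qed
        show ?thesis
        proof (cases "kimb_pos a = i + 1 \<and> i + e = kimb_pos z + 3")
          case True
          \<comment> \<open>Four loose bits force the pair {A, C} on the left and {B, C} on the
            right, and the sharper bound asks for different pairs.\<close>
          have "{A, C} \<noteq> {B, C}" by auto
          then have "W z + 4 \<le> W a + kappa * (real j - i)"
            using tribonacci_maximal_match_bound[OF md \<open>a < b\<close>, of 0, unfolded ad] right left l1 r3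
              True ab
            by (simp add: p ts W_def)
          then show ?thesis using True unfolding pos by simp
        next
          case False
          then have "i + e + kimb_pos a \<le> i + kimb_pos z + 3" using l r by linarith
          then show ?thesis using bound unfolding pos by simp
        qed
      qed
    qed
  qed
qed

lemma kimberling_match_bound:
  assumes m: "matches kimberling i j e" and "i < j"
  shows "e \<le> kappa * (real j - i)"
proof -
  obtain a where a: "i \<le> kimb_pos a" "kimb_pos a \<le> i + 2" "a = 0 \<or> kimb_pos (a - 1) < i"
  proof (cases "i = 0")
    case True
    then show ?thesis using that[of 0] by simp
  next
    case False
    then obtain k where k: "kimb_pos k \<le> i" "i < kimb_pos (Suc k)"
      using kimb_pos_interval by blast
    show ?thesis
    proof (cases "kimb_pos k = i")
      case True
      then show ?thesis using that[of k] kimb_pos_less_Suc(1)[of "k - 1"] by (cases k) auto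
    next
      case False
      then show ?thesis using that[of "Suc k"] k kimb_pos_less_Suc(2)[of k] by auto
    qed
  qed
  show ?thesis
  proof (cases "kimb_pos a + 2 \<le> i + e")
    case True
    then show ?thesis using kimberling_match_bound_aligned[OF m \<open>i < j\<close> a] by blast
  next
    case False
    \<comment> \<open>Here \<open>e\<close> is at most 3, so only shift 1 with \<open>e = 3\<close>
      could fail; that would equate the 1 and the 0 of the 10 at \<open>i + 2\<close>.\<close>
    have "e \<le> 2 * (j - i)"
    proof (rule ccontr)
      assume "\<not> ?thesis"
      then have "j = Suc i" "e = 3" "kimb_pos a = i + 2" using False a \<open>i < j\<close> by linarith+
      then show False
        using matchesD[OF m, of 2] kimberling_kimb_pos[of a] by simp
    qed
    then have "real e \<le> 2 * (real j - i)" using \<open>i < j\<close>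
      by (simp add: le_diff_conv2 flip: of_nat_diff)
    also have "\<dots> \<le> kappa * (real j - i)"
      using kappa_bounds \<open>i < j\<close> by (intro mult_right_mono) auto
    finally show ?thesis .
  qed
qed

section \<open>Lower bound: lifting matches through \<open>tau\<close> and the coding\<close>

lemma matches_add:
  "matches x i j (e + f) \<longleftrightarrow> matches x i j e \<and> matches x (i + e) (j + e) f"
  by (induction f) (auto simp: matches_Suc matches_def[of _ _ _ 0] add.assoc)

lemma tribonacci_match_image:
  assumes "matches tribonacci i j e"
  shows "\<exists>f. tau_pos i + f = tau_pos (i + e) \<and> tau_pos j + f = tau_pos (j + e)
    \<and> matches tribonacci (tau_pos i) (tau_pos j) f"
  using assms
proof (induction e)
  case 0
  then show ?case by (simp add: matches_def)
next
  case (Suc e)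
  then obtain f where "tau_pos i + f = tau_pos (i + e)" "tau_pos j + f = tau_pos (j + e)"
    "matches tribonacci (tau_pos i) (tau_pos j) f" "tribonacci (i + e) = tribonacci (j + e)"
    by (auto simp: matches_Suc)
  moreover from this have "matches tribonacci (tau_pos i + f) (tau_pos j + f)
      (length (trib_image (tribonacci (i + e))))"
    by (simp add: matches_def tribonacci_tau_pos_add)
  ultimately show ?case
    by (intro exI[of _ "f + length (trib_image (tribonacci (i + e)))"])
       (simp add: matches_add tau_pos_Suc)
qed

lemma kimberling_match_image:
  assumes "matches tribonacci i j e"
  shows "\<exists>f. kimb_pos i + f = kimb_pos (i + e) \<and> kimb_pos j + f = kimb_pos (j + e)
    \<and> matches kimberling (kimb_pos i) (kimb_pos j) f"
  using assms
proof (induction e)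
  case 0
  then show ?case by (simp add: matches_def)
next
  case (Suc e)
  then obtain f where "kimb_pos i + f = kimb_pos (i + e)" "kimb_pos j + f = kimb_pos (j + e)"
    "matches kimberling (kimb_pos i) (kimb_pos j) f" "tribonacci (i + e) = tribonacci (j + e)"
    by (auto simp: matches_Suc)
  moreover from this have "matches kimberling (kimb_pos i + f) (kimb_pos j + f)
      (length (kimb_image (tribonacci (i + e))))"
    by (simp add: matches_def kimberling_kimb_pos_add)
  ultimately show ?case
    by (intro exI[of _ "f + length (kimb_image (tribonacci (i + e)))"])
       (simp add: matches_add kimb_pos_Suc)
qed

text \<open>The descent reversed: each of the \<open>n\<close> applications of \<open>tau\<close>
  gains one A, which opens the next image in both copies. The slack 3 is \<open>trib_sum 2\<close>,
  since the coding step adds no loose bits.\<close>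

lemma kimberling_match_exists:
  assumes "matches tribonacci i j e" "i < j"
  shows "\<exists>i' j' e'. matches kimberling i' j' e' \<and> i' < j' \<and>
    i' + weight_sum n j = j' + weight_sum n i \<and>
    weight_sum n (i + e) + trib_sum (n + 2) \<le> weight_sum n i + e' + 3"
  using assms
proof (induction n arbitrary: i j e)
  case 0
  then obtain f where f: "kimb_pos i + f = kimb_pos (i + e)"
    "matches kimberling (kimb_pos i) (kimb_pos j) f"
    using kimberling_match_image[OF "0.prems"(1)] by blast
  have "kimb_pos i < kimb_pos j"
    using \<open>i < j\<close> by (simp add: strict_mono_less[OF strict_mono_kimb_pos])
  moreover have "weight_sum 0 (i + e) + trib_sum (0 + 2) \<le> weight_sum 0 i + f + 3"
    using f(1) by (simp add: kimb_pos_def numeral_2_eq_2)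
  moreover have "kimb_pos i + weight_sum 0 j = kimb_pos j + weight_sum 0 i"
    by (simp add: kimb_pos_def)
  ultimately show ?case using f(2) by blast
next
  case (Suc n)
  then obtain f where f: "tau_pos i + f = tau_pos (i + e)" "tau_pos j + f = tau_pos (j + e)"
    "matches tribonacci (tau_pos i) (tau_pos j) f"
    using tribonacci_match_image[OF Suc.prems(1)] by blast
  then have "matches tribonacci (tau_pos i) (tau_pos j) (Suc f)" by (simp add: matches_Suc)
  moreover have "tau_pos i < tau_pos j"
    using \<open>i < j\<close> by (simp add: strict_mono_less[OF strict_mono_tau_pos])
  ultimately obtain i' j' e' where "matches kimberling i' j' e'" "i' < j'"
    "i' + weight_sum n (tau_pos j) = j' + weight_sum n (tau_pos i)"
    "weight_sum n (tau_pos i + Suc f) + trib_sum (n + 2) \<le> weight_sum n (tau_pos i) + e' + 3"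
    using Suc.IH by metis
  moreover have "weight_sum n (tau_pos i + Suc f) = weight_sum (Suc n) (i + e) + trib (n + 2)"
    by (simp add: f(1) weight_sum_Suc weight_sum_tau_pos)
  ultimately show ?case
    by (intro exI[of _ i'] exI[of _ j'] exI[of _ e']) (simp add: weight_sum_tau_pos)
qed

lemma tribonacci_3: "tribonacci 3 = C"
proof -
  have "tribonacci 1 = B" using tribonacci_tau_pos_1[of 0] by simp
  moreover have "tau_pos 1 = 2" using tau_pos_Suc[of 0] by simp
  ultimately show ?thesis using tribonacci_tau_pos_1[of 1]
    by (simp add: numeral_3_eq_3 numeral_2_eq_2)
qed


section \<open>The critical exponent\<close>

lemma has_period_per: "w \<noteq> [] \<Longrightarrow> has_period w (per w)"
  unfolding per_def by (rule LeastI[of _ "length w"]) (simp add: has_period_def Suc_le_eq)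

lemma has_period_subsequence:
  "has_period (x [i \<rightarrow> i + p + e]) p \<longleftrightarrow> 1 \<le> p \<and> matches x i (i + p) e"
  by (auto simp: has_period_def matches_def ac_simps)

lemma exponent_kimberling_le:
  assumes "w \<noteq> []" "is_factor w kimberling"
  shows "exponent w \<le> 1 + kappa"
proof -
  obtain i j where w: "w = kimberling [i \<rightarrow> j]" using assms by (auto simp: is_factor_def)
  define p where "p = per w"
  have p: "has_period w p" "1 \<le> p"
    using has_period_per[OF assms(1)] by (auto simp: p_def has_period_def)
  have "real (length w) \<le> (1 + kappa) * p"
  proof (cases "length w \<le> p")
    case True
    then have "real (length w) \<le> 1 * real p" by simp
    also have "\<dots> \<le> (1 + kappa) * p" using kappa_gt_1 by (intro mult_right_mono) auto
    finally show ?thesis .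
  next
    case False
    define e where "e = length w - p"
    have j: "j = i + p + e" using False w by (simp add: e_def)
    have "matches kimberling i (i + p) e" using p(1) unfolding w j has_period_subsequence by simp
    then have "real e \<le> kappa * (real (i + p) - i)" using p by (intro kimberling_match_bound) auto
    then show ?thesis using False by (simp add: e_def algebra_simps)
  qed
  then show ?thesis using p by (simp add: exponent_def p_def[symmetric] field_simps)
qed

text \<open>\<open>p\<close> may exceed the least period, which only raises the exponent.\<close>

lemma exponent_subsequence_ge:
  assumes "matches x i (i + p) e" "1 \<le> p"
  shows "1 + e / p \<le> exponent (x [i \<rightarrow> i + p + e])"
proof -
  let ?w = "x [i \<rightarrow> i + p + e]"
  have "has_period ?w p" unfolding has_period_subsequence using assms by simp
  then have "per ?w \<le> p" unfolding per_def by (rule Least_le)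
  moreover have "length ?w > 0" using assms by simp
  then have "?w \<noteq> []" unfolding length_greater_0_conv .
  then have "1 \<le> per ?w" using has_period_per[of ?w] by (simp add: has_period_def)
  ultimately have "real (p + e) / p \<le> real (p + e) / per ?w"
    by (intro divide_left_mono) auto
  then show ?thesis using assms by (simp add: exponent_def add_divide_distrib)
qed

lemma critical_exponent_kimberling: "critical_exponent kimberling = ereal (1 + kappa)"
  unfolding critical_exponent_def
proof (intro antisym Sup_least)
  fix y assume "y \<in> {ereal (exponent w) | w. w \<noteq> [] \<and> is_factor w kimberling}"
  then show "y \<le> ereal (1 + kappa)" using exponent_kimberling_le by auto
next
  let ?S = "Sup {ereal (exponent w) | w. w \<noteq> [] \<and> is_factor w kimberling}"
  have lower: "ereal (1 + kappa - 6 / trib (n + 1)) \<le> ?S" for n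
  proof -
    \<comment> \<open>The C at position 3 as period word of an empty match: at level
      \<open>n\<close> it has the least possible weight, \<open>trib (n + 1)\<close>.\<close>
    have "matches tribonacci 3 4 0" by (simp add: matches_def)
    then obtain i j e where m: "matches kimberling i j e" "i < j"
      "i + weight_sum n 4 = j + weight_sum n 3"
      "weight_sum n 3 + trib_sum (n + 2) \<le> weight_sum n 3 + e + 3"
      using kimberling_match_exists[of 3 4 0 n] by auto
    have "weight_sum n 4 = weight_sum n 3 + trib (n + 1)"
      using weight_sum_Suc[of n 3] tribonacci_3 by simp
    then have j: "j = i + trib (n + 1)" using m by simp
    \<comment> \<open>The 6 is 3 from \<open>kimberling_match_exists\<close> plus 3 from
      \<open>trib_sum_ge\<close>.\<close>
    have "kappa * trib (n + 1) - 6 \<le> e"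
      using m(4) trib_sum_ge[of "n + 1"] by simp
    then have "(kappa * trib (n + 1) - 6) / trib (n + 1) \<le> e / trib (n + 1)"
      by (rule divide_right_mono) simp
    then have "1 + kappa - 6 / trib (n + 1) \<le> 1 + e / trib (n + 1)"
      using trib_gt[of "n + 1"] by (simp add: diff_divide_distrib)
    also have "\<dots> \<le> exponent (kimberling [i \<rightarrow> i + trib (n + 1) + e])"
      using m(1) trib_gt[of "n + 1"] unfolding j by (intro exponent_subsequence_ge) auto
    finally have "ereal (1 + kappa - 6 / trib (n + 1))
        \<le> ereal (exponent (kimberling [i \<rightarrow> i + trib (n + 1) + e]))" by simp
    also have "\<dots> \<le> ?S"
    proof (rule Sup_upper)
      have "length (kimberling [i \<rightarrow> i + trib (n + 1) + e]) > 0"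
        using trib_gt[of "n + 1"] by simp
      then show "ereal (exponent (kimberling [i \<rightarrow> i + trib (n + 1) + e]))
        \<in> {ereal (exponent w) | w. w \<noteq> [] \<and> is_factor w kimberling}"
        unfolding is_factor_def length_greater_0_conv by blast
    qed
    finally show ?thesis .
  qed
  have "(\<lambda>n. 6 / real (trib (n + 1))) \<longlonglongrightarrow> 0"
  proof (rule tendsto_sandwich[of "\<lambda>_. 0" _ _ "\<lambda>n. 6 / real n"])
    show "\<forall>\<^sub>F n in sequentially. 6 / real (trib (n + 1)) \<le> 6 / real n"
    proof (rule eventually_sequentiallyI[of 1])
      fix n :: nat assume "1 \<le> n"
      then show "6 / real (trib (n + 1)) \<le> 6 / real n"
        using trib_gt[of "n + 1"] by (intro divide_left_mono) auto
    qed
  qed (auto intro: lim_const_over_n)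
  then have "(\<lambda>n. 1 + kappa - 6 / real (trib (n + 1))) \<longlonglongrightarrow> 1 + kappa - 0"
    by (intro tendsto_intros)
  then have "(\<lambda>n. ereal (1 + kappa - 6 / trib (n + 1))) \<longlonglongrightarrow> ereal (1 + kappa)" by simp
  then show "ereal (1 + kappa) \<le> ?S" by (rule LIMSEQ_le_const2) (use lower in blast)
qed

theorem theorem6:
  "critical_exponent kimberling = ereal (2 + 1 / (psi - 1)) \<and>
   3.19148788395 \<le> 2 + 1 / (psi - 1) \<and> 2 + 1 / (psi - 1) < 3.19148788396"
proof -
  have "2 + 1 / (psi - 1) = 1 + kappa" by (simp add: kappa_def)
  then show ?thesis using critical_exponent_kimberling kappa_bounds by simp
qed

end
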